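(* Let $n=1$ and let $m,\ell\geq 0$ be integers. The Born--Jordan quantization $\widehat{H}$ of the monomial Hamiltonian $H(x,p)=x^mp^\ell$, defined by $$\widehat{H}\psi(x)=\frac{1}{2\pi\hbar}\int e^{\frac{i}{\hbar}p(x-x')}\left(\int_0^1 H(\tau x+(1-\tau)x',p)\,d\tau\right)\psi(x')\,dp\,dx',$$ is given by the Born--Jordan rule $$\widehat{H}=\frac{1}{m+1}\sum_{k=0}^m\widehat{x}^{\,k}\,\widehat{p}^{\,\ell}\,\widehat{x}^{\,m-k}.$$
   Context: $\hbar>0$ is a constant. $\widehat{x}$ is the operator of multiplication by $x$ and $\widehat{p}=-i\hbar\,\partial/\partial x$. The integral over $p$ is understood in the distributional sense, i.e. through the Fourier formula $\frac{1}{2\pi\hbar}\int_{-\infty}^{\infty}e^{\frac{i}{\hbar}p(x-x')}p^\ell\,dp=(-i\hbar)^\ell\delta^{(\ell)}(x-x')$. *)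

theory Defs
  imports "HOL-Analysis.Analysis"
begin

definition D :: "(real \<Rightarrow> complex) \<Rightarrow> real \<Rightarrow> complex" where
  "D f = (\<lambda>x. vector_derivative f (at x))"

text \<open>
  The first clause, for all k, says that f is smooth and makes the iterates of D genuine
  derivatives (vector_derivative is unspecified where the derivative does not exist).
\<close>

definition schwartz :: "(real \<Rightarrow> complex) set" where
  "schwartz = {f. \<forall>k. (\<forall>x. (D ^^ k) f differentiable (at x)) \<and>
                      (\<forall>j. \<exists>C. \<forall>x. \<bar>x\<bar> ^ j * norm ((D ^^ k) f x) \<le> C)}"

definition x_op :: "(real \<Rightarrow> complex) \<Rightarrow> real \<Rightarrow> complex" where
  "x_op \<psi> = (\<lambda>x. of_real x * \<psi> x)"

definition p_op :: "real \<Rightarrow> (real \<Rightarrow> complex) \<Rightarrow> real \<Rightarrow> complex" where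
  "p_op hbar \<psi> = (\<lambda>x. - \<i> * of_real hbar * D \<psi> x)"

text \<open>
  For fixed x, the following functional of the test function \<open>\<psi>\<close> is the distribution in x'
  written formally as \<open>1 / (2 \<pi> hbar) \<integral> exp ((\<i> / hbar) p (x - x')) a x' p dp\<close>.  As for the
  Fourier transform of a tempered distribution, the integral over p is taken after pairing
  with \<open>\<psi>\<close>; as a double integral over (x', p), or with the p-integral taken first
  pointwise in x', it does not converge in general.  With \<open>a x' p = p ^ l\<close> it is the left-hand
  side of the Fourier formula, whose right-hand side \<open>(- \<i> hbar)^l \<delta>\<^sup>(\<^sup>l\<^sup>)(x - x')\<close> sends
  \<open>\<psi>\<close> to \<open>(p_op hbar ^^ l) \<psi> x\<close>; this formula is not built into the definition.
\<close>

definition osc_pairing ::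
  "real \<Rightarrow> real \<Rightarrow> (real \<Rightarrow> real \<Rightarrow> complex) \<Rightarrow> (real \<Rightarrow> complex) \<Rightarrow> complex" where
  "osc_pairing hbar x a \<psi> =
     1 / (2 * of_real pi * of_real hbar) *
     (LINT p|lborel. (LINT x'|lborel.
        exp (\<i> / of_real hbar * of_real (p * (x - x'))) * a x' p * \<psi> x'))"

definition born_jordan_quantization ::
  "real \<Rightarrow> (real \<Rightarrow> real \<Rightarrow> complex) \<Rightarrow> (real \<Rightarrow> complex) \<Rightarrow> real \<Rightarrow> complex" where
  "born_jordan_quantization hbar H \<psi> = (\<lambda>x.
     osc_pairing hbar x (\<lambda>x' p. LINT \<tau>:{0..1}|lborel. H (\<tau> * x + (1 - \<tau>) * x') p) \<psi>)"

end

(* Averaging (\<tau> x + (1 - \<tau>) x')^m over \<tau> gives 1/(m+1) times the sum of x^k x'^(m-k), so by linearity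
   it suffices to treat the symbol p^l applied to the Schwartz functions x^(m-k) \<psi>.  There p^l turns
   into l derivatives under the Fourier transform, and Fourier inversion finishes the proof.
   Inversion is obtained by inserting a factor exp (-(s t)^2 / 2) into the t-integral: Fubini then
   turns it into a Gaussian mean of the function around x with standard deviation s, and s tends
   to 0 on both sides. *)

theory Submission
  imports Defs "HOL-Probability.Characteristic_Functions" "HOL-Probability.Sinc_Integral"
begin

section \<open>Schwartz functions\<close>

lemma schwartz_D:
  assumes "f \<in> schwartz"
  shows "D f \<in> schwartz"
proof -
  have *: "(D ^^ k) (D f) = (D ^^ Suc k) f" for k
    by (simp only: funpow_Suc_right o_apply)
  show ?thesis
    using assms unfolding schwartz_def mem_Collect_eq * by blast
qed

lemma schwartz_funpow_D: "f \<in> schwartz \<Longrightarrow> (D ^^ k) f \<in> schwartz"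
  by (induction k) (auto intro: schwartz_D)

text \<open>The clause k = 0 of \<open>schwartz_def\<close> turns the otherwise unspecified
  \<open>D f x\<close> into a genuine derivative; later differentiations of Schwartz functions rest
  on this.\<close>

lemma schwartz_has_vector_derivative:
  assumes "f \<in> schwartz"
  shows "(f has_vector_derivative D f x) (at x)"
proof -
  have "(D ^^ 0) f differentiable (at x)"
    using assms unfolding schwartz_def by blast
  then show ?thesis
    by (simp add: D_def vector_derivative_works)
qed

lemma schwartz_continuous: "f \<in> schwartz \<Longrightarrow> continuous_on UNIV f"
  by (intro continuous_at_imp_continuous_on ballI)
    (rule has_vector_derivative_continuous[OF schwartz_has_vector_derivative])

lemma schwartz_measurable: "f \<in> schwartz \<Longrightarrow> f \<in> borel_measurable borel"
  by (intro borel_measurable_continuous_onI schwartz_continuous)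

lemma schwartz_moment_bound:
  assumes "f \<in> schwartz"
  obtains C where "\<And>x. \<bar>x\<bar> ^ j * norm (f x) \<le> C"
proof -
  have "\<exists>C. \<forall>x. \<bar>x\<bar> ^ j * norm ((D ^^ 0) f x) \<le> C"
    using assms unfolding schwartz_def by blast
  with that show ?thesis by auto
qed

lemma schwartz_bounded:
  assumes "f \<in> schwartz"
  obtains C where "\<And>x. norm (f x) \<le> C"
  using schwartz_moment_bound[OF assms, of 0] by auto

section \<open>Multiplication by x and iterated derivatives\<close>

lemma has_vector_derivative_x_op:
  assumes "(f has_vector_derivative f') (at x)"
  shows "(x_op f has_vector_derivative of_real x * f' + f x) (at x)"
proof -
  have "((\<lambda>x. of_real x * f x) has_vector_derivative (of_real x * f' + of_real 1 * f x)) (at x)"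
    by (intro has_vector_derivative_mult has_vector_derivative_of_real assms)
      (auto intro!: derivative_eq_intros)
  then show ?thesis
    by (simp add: x_op_def[abs_def])
qed

lemma has_vector_derivative_funpow_D:
  "f \<in> schwartz \<Longrightarrow> ((D ^^ k) f has_vector_derivative (D ^^ Suc k) f x) (at x)"
  using schwartz_has_vector_derivative[OF schwartz_funpow_D] by simp

text \<open>Leibniz rule with only two terms, since the second derivative of x vanishes. The
  truncated \<open>k - 1\<close> is harmless at k = 0, where the coefficient is 0. One derivative
  computation yields both conclusions.\<close>

lemma
  assumes f: "f \<in> schwartz"
  shows funpow_D_x_op: "(D ^^ k) (x_op f) = (\<lambda>x. of_real x * (D ^^ k) f x + of_nat k * (D ^^ (k - 1)) f x)"
    and has_vector_derivative_funpow_D_x_op: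
      "((D ^^ k) (x_op f) has_vector_derivative (D ^^ Suc k) (x_op f) x) (at x)"
proof -
  \<comment> \<open>Differentiating the formula for k gives the formula for k + 1. Proved before the
    formula itself, this supplies the existence of the derivative on which the induction evaluates
    \<open>D\<close>.\<close>
  have step: "((\<lambda>x. of_real x * (D ^^ k) f x + of_nat k * (D ^^ (k - 1)) f x) has_vector_derivative
      of_real x * (D ^^ Suc k) f x + of_nat (Suc k) * (D ^^ k) f x) (at x)" for k x
  proof -
    have 1: "((\<lambda>x. of_real x * (D ^^ k) f x) has_vector_derivative
        of_real x * (D ^^ Suc k) f x + (D ^^ k) f x) (at x)"
      using has_vector_derivative_x_op[OF has_vector_derivative_funpow_D[OF f]]
      by (simp add: x_op_def[abs_def])
    have 2: "((\<lambda>x. of_nat k * (D ^^ (k - 1)) f x) has_vector_derivative of_nat k * (D ^^ k) f x) (at x)"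
    proof (cases k)
      case (Suc j)
      show ?thesis
        unfolding Suc using has_vector_derivative_funpow_D[OF f, of j x]
        by (intro has_vector_derivative_mult_right) simp
    qed simp
    show ?thesis
      using has_vector_derivative_add[OF 1 2] by (simp add: algebra_simps)
  qed
  have eq: "(D ^^ k) (x_op f) = (\<lambda>x. of_real x * (D ^^ k) f x + of_nat k * (D ^^ (k - 1)) f x)" for k
  proof (induction k)
    case 0
    show ?case by (simp add: x_op_def)
  next
    case (Suc k)
    have "(D ^^ Suc k) (x_op f) x = of_real x * (D ^^ Suc k) f x + of_nat (Suc k) * (D ^^ k) f x" for x
      using vector_derivative_at[OF step[of k x]] unfolding funpow.simps o_apply Suc.IH D_def[of "\<lambda>x. _ x + _ x"] .
    then show ?case by auto
  qed
  show "(D ^^ k) (x_op f) = (\<lambda>x. of_real x * (D ^^ k) f x + of_nat k * (D ^^ (k - 1)) f x)"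
    by (rule eq)
  show "((D ^^ k) (x_op f) has_vector_derivative (D ^^ Suc k) (x_op f) x) (at x)"
    using step[of k x] unfolding eq by simp
qed

text \<open>By the two-term Leibniz rule, a moment of order j is controlled by the moment of order j
  + 1 of the k-th derivative of f and the moment of order j of the preceding derivative.\<close>

lemma schwartz_x_op:
  assumes f: "f \<in> schwartz"
  shows "x_op f \<in> schwartz"
  unfolding schwartz_def
proof (intro CollectI allI conjI)
  fix k j x
  show "(D ^^ k) (x_op f) differentiable (at x)"
    using has_vector_derivative_funpow_D_x_op[OF f] differentiableI_vector by blast
  obtain A where A: "\<And>x. \<bar>x\<bar> ^ Suc j * norm ((D ^^ k) f x) \<le> A"
    using schwartz_moment_bound[OF schwartz_funpow_D[OF f]] by blast
  obtain B where B: "\<And>x. \<bar>x\<bar> ^ j * norm ((D ^^ (k - 1)) f x) \<le> B"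
    using schwartz_moment_bound[OF schwartz_funpow_D[OF f]] by blast
  have "\<bar>x\<bar> ^ j * norm ((D ^^ k) (x_op f) x) \<le> A + of_nat k * B" for x
  proof -
    have "\<bar>x\<bar> ^ j * norm ((D ^^ k) (x_op f) x)
        \<le> \<bar>x\<bar> ^ j * (\<bar>x\<bar> * norm ((D ^^ k) f x) + of_nat k * norm ((D ^^ (k - 1)) f x))"
      unfolding funpow_D_x_op[OF f]
      by (intro mult_left_mono order_trans[OF norm_triangle_ineq]) (auto simp: norm_mult)
    also have "\<dots> = \<bar>x\<bar> ^ Suc j * norm ((D ^^ k) f x) + of_nat k * (\<bar>x\<bar> ^ j * norm ((D ^^ (k - 1)) f x))"
      by (simp add: algebra_simps)
    also have "\<dots> \<le> A + of_nat k * B"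
      by (intro add_mono A mult_left_mono B) auto
    finally show ?thesis .
  qed
  then show "\<exists>C. \<forall>x. \<bar>x\<bar> ^ j * norm ((D ^^ k) (x_op f) x) \<le> C"
    by blast
qed

lemma schwartz_funpow_x_op: "f \<in> schwartz \<Longrightarrow> (x_op ^^ k) f \<in> schwartz"
  by (induction k) (auto intro: schwartz_x_op)

lemma funpow_x_op: "(x_op ^^ k) f x = of_real (x ^ k) * f x"
  by (induction k) (auto simp: x_op_def)

text \<open>The constants collected so far pass through the next \<open>D\<close> because the
  iterated derivatives of f are differentiable.\<close>

lemma funpow_p_op:
  assumes f: "f \<in> schwartz"
  shows "(p_op hbar ^^ l) f = (\<lambda>x. (- \<i> * of_real hbar) ^ l * (D ^^ l) f x)"
proof (induction l)
  case (Suc l)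
  have "D (\<lambda>x. (- \<i> * of_real hbar) ^ l * (D ^^ l) f x) x
      = (- \<i> * of_real hbar) ^ l * (D ^^ Suc l) f x" for x
    unfolding D_def[of "\<lambda>x. _ x * _ x"]
    by (intro vector_derivative_at has_vector_derivative_mult_right has_vector_derivative_funpow_D f)
  then show ?case
    by (simp add: Suc.IH p_op_def[of _ "\<lambda>x. _ x * _ x"] fun_eq_iff)
qed auto

section \<open>Integrability and decay at infinity\<close>

lemma integrable_inverse_1_plus_square_real: "integrable lborel (\<lambda>x::real. inverse (1 + x\<^sup>2))"
  using integrable_inverse_1_plus_square by (simp add: set_integrable_def)

text \<open>The two bounds add up to (1 + x^2) |f x| \<le> A + B, so 1 / (1 + x^2) serves as
  majorant. The criterion is applied both to Schwartz functions and to their Fourier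
  transforms.\<close>

lemma integrable_of_quadratic_decay:
  fixes f :: "real \<Rightarrow> complex"
  assumes "f \<in> borel_measurable borel" "\<And>x. norm (f x) \<le> A" "\<And>x. x\<^sup>2 * norm (f x) \<le> B"
  shows "integrable lborel f"
proof (rule Bochner_Integration.integrable_bound)
  show "integrable lborel (\<lambda>x::real. (A + B) * inverse (1 + x\<^sup>2))"
    by (intro integrable_mult_right integrable_inverse_1_plus_square_real)
  have "norm (f x) \<le> (A + B) * inverse (1 + x\<^sup>2)" for x
  proof -
    have "0 < 1 + x\<^sup>2" by (simp add: add_pos_nonneg)
    then show ?thesis
      using assms(2,3)[of x] by (simp add: field_simps)
  qed
  then show "AE x in lborel. norm (f x) \<le> norm ((A + B) * inverse (1 + x\<^sup>2))"
    by (intro AE_I2) (metis abs_ge_self order_trans real_norm_def)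
qed (use assms in simp)

lemma schwartz_integrable:
  assumes f: "f \<in> schwartz"
  shows "integrable lborel f"
proof -
  obtain A B where "\<And>x. norm (f x) \<le> A" "\<And>x. \<bar>x\<bar> ^ 2 * norm (f x) \<le> B"
    using schwartz_bounded[OF f] schwartz_moment_bound[OF f] by metis
  then show ?thesis
    by (intro integrable_of_quadratic_decay[of _ A B] schwartz_measurable f) auto
qed

text \<open>A bounded first moment forces decay like 1 / |x|. The limits become the boundary terms
  when the Fourier integral is integrated by parts.\<close>

lemma schwartz_tendsto_0:
  assumes f: "f \<in> schwartz"
  shows "(f \<longlongrightarrow> 0) at_top" "(f \<longlongrightarrow> 0) at_bot"
proof -
  obtain C where C: "\<And>x. \<bar>x\<bar> ^ 1 * norm (f x) \<le> C"
    using schwartz_moment_bound[OF f] by blast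
  have *: "norm (f x) \<le> C / \<bar>x\<bar>" if "x \<noteq> 0" for x
    using C[of x] that by (simp add: field_simps)
  have "((\<lambda>x::real. C / \<bar>x\<bar>) \<longlongrightarrow> 0) at_top"
    by (intro tendsto_divide_0[OF tendsto_const] filterlim_at_top_imp_at_infinity filterlim_abs_real)
  then show "(f \<longlongrightarrow> 0) at_top"
    by (rule Lim_null_comparison[rotated])
      (rule eventually_mono[OF eventually_gt_at_top[of 0]], rule *, simp)
  have "filterlim (\<lambda>x::real. \<bar>x\<bar>) at_top at_bot"
    by (rule filterlim_abs_real[THEN filterlim_compose, of "\<lambda>x. -x", simplified])
      (rule filterlim_uminus_at_top_at_bot)
  then have "((\<lambda>x::real. C / \<bar>x\<bar>) \<longlongrightarrow> 0) at_bot"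
    by (intro tendsto_divide_0[OF tendsto_const] filterlim_at_top_imp_at_infinity)
  then show "(f \<longlongrightarrow> 0) at_bot"
    by (rule Lim_null_comparison[rotated])
      (rule eventually_mono[OF eventually_gt_at_bot[of 0]], rule *, simp)
qed

section \<open>The Fourier transform\<close>

text \<open>Unnormalized convention without hbar: inversion therefore carries the factor 2 \<pi>,
  and hbar enters only through the rescaling t = p / hbar.\<close>

definition fourier :: "(real \<Rightarrow> complex) \<Rightarrow> real \<Rightarrow> complex" where
  "fourier f t = (LINT y|lborel. iexp (- (t * y)) * f y)"

lemma integrable_iexp_mult:
  assumes "integrable lborel f"
  shows "integrable lborel (\<lambda>y. iexp (t * y) * f y)"
  by (rule Bochner_Integration.integrable_bound[OF assms])
    (use assms in \<open>auto simp: norm_mult intro!: borel_measurable_times\<close>)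

lemma norm_fourier_le:
  "norm (fourier f t) \<le> (LINT y|lborel. norm (f y))"
proof -
  have "norm (fourier f t) \<le> (LINT y|lborel. norm (iexp (- (t * y)) * f y))"
    unfolding fourier_def by (rule integral_norm_bound)
  then show ?thesis by (simp add: norm_mult)
qed

lemma fourier_measurable:
  assumes [measurable]: "f \<in> borel_measurable borel"
  shows "fourier f \<in> borel_measurable borel"
  unfolding fourier_def[abs_def] by measurable

text \<open>Integration by parts, done as the fundamental theorem of calculus on the whole line for
  the product of the exponential with f.\<close>

lemma fourier_D:
  assumes f: "f \<in> schwartz"
  shows "fourier (D f) t = \<i> * of_real t * fourier f t"
proof -
  let ?e = "\<lambda>y. iexp (- (t * y))"
  have int: "integrable lborel (\<lambda>y. ?e y * g y)" if "g \<in> schwartz" for g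
    using integrable_iexp_mult[OF schwartz_integrable[OF that], of "-t"] by simp
  have deriv: "((\<lambda>y. ?e y * f y) has_vector_derivative (?e y * D f y - \<i> * of_real t * (?e y * f y))) (at y)"
    for y
  proof -
    have "((iexp \<circ> (\<lambda>y. - (t * y))) has_vector_derivative ((- t) *\<^sub>R (\<i> * ?e y))) (at y)"
      by (rule vector_diff_chain_at) (auto intro!: derivative_eq_intros has_vector_derivative_iexp)
    then have "(?e has_vector_derivative (- t) *\<^sub>R (\<i> * ?e y)) (at y)"
      by (simp add: o_def)
    from has_vector_derivative_mult[OF this schwartz_has_vector_derivative[OF f]]
    show ?thesis by (simp add: scaleR_conv_of_real algebra_simps)
  qed
  \<comment> \<open>The exponential has modulus 1, so the product tends to 0 together with
    f.\<close>
  have lim: "((\<lambda>y. ?e y * f y) \<longlongrightarrow> 0) F" if "(f \<longlongrightarrow> 0) F" for F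
    by (rule tendsto_norm_zero_cancel) (use tendsto_norm_zero[OF that] in \<open>simp add: norm_mult\<close>)
  have "(LBINT y=-\<infinity>..\<infinity>. ?e y * D f y - \<i> * of_real t * (?e y * f y)) = 0 - 0"
  proof (rule interval_integral_FTC_integrable)
    show "isCont (\<lambda>y. ?e y * D f y - \<i> * of_real t * (?e y * f y)) x" for x
      using schwartz_continuous[OF f] schwartz_continuous[OF schwartz_D[OF f]]
      by (intro continuous_intros) (auto simp: continuous_on_eq_continuous_at)
    show "set_integrable lborel (einterval (-\<infinity>) \<infinity>) (\<lambda>y. ?e y * D f y - \<i> * of_real t * (?e y * f y))"
      using int[OF f] int[OF schwartz_D[OF f]] by (simp add: set_integrable_def)
    show "(((\<lambda>y. ?e y * f y) \<circ> real_of_ereal) \<longlongrightarrow> 0) (at_right (-\<infinity>))"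
      "(((\<lambda>y. ?e y * f y) \<circ> real_of_ereal) \<longlongrightarrow> 0) (at_left \<infinity>)"
      unfolding ereal_tendsto_simps by (intro lim schwartz_tendsto_0 f)+
  qed (use deriv in simp_all)
  then have "(LINT y|lborel. ?e y * D f y - \<i> * of_real t * (?e y * f y)) = 0"
    by (simp add: interval_integral_to_infinity_eq interval_lebesgue_integral_def set_lebesgue_integral_def)
  then show ?thesis
    using int[OF f] int[OF schwartz_D[OF f]] by (simp add: fourier_def)
qed

lemma fourier_funpow_D:
  assumes f: "f \<in> schwartz"
  shows "fourier ((D ^^ l) f) t = (\<i> * of_real t) ^ l * fourier f t"
  by (induction l) (auto simp: fourier_D schwartz_funpow_D f)

text \<open>The transform is bounded by the L1 norm of f, and t^2 times it is, up to sign, the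
  transform of the second derivative, hence bounded as well.\<close>

lemma fourier_integrable:
  assumes f: "f \<in> schwartz"
  shows "integrable lborel (fourier f)"
proof (rule integrable_of_quadratic_decay)
  show "fourier f \<in> borel_measurable borel"
    by (intro fourier_measurable schwartz_measurable f)
  show "norm (fourier f t) \<le> (LINT y|lborel. norm (f y))" for t
    by (rule norm_fourier_le)
  show "t\<^sup>2 * norm (fourier f t) \<le> (LINT y|lborel. norm ((D ^^ 2) f y))" for t
    using norm_fourier_le[of "(D ^^ 2) f" t]
    by (simp add: fourier_funpow_D[OF f] norm_mult norm_power power_mult_distrib)
qed

section \<open>Fourier inversion\<close>

text \<open>The Gaussian is its own Fourier transform up to a constant: the right-hand side is exp
  (- t^2 / 2), the characteristic function of the standard normal law.\<close>

lemma fourier_std_normal_density: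
  "(LINT u|lborel. iexp (t * u) * of_real (std_normal_density u))
    = of_real (sqrt (2 * pi) * std_normal_density t)"
proof -
  have "(LINT u|lborel. iexp (t * u) * of_real (std_normal_density u))
      = (LINT u|lborel. std_normal_density u *\<^sub>R iexp (t * u))"
    by (simp add: scaleR_conv_of_real mult.commute)
  also have "\<dots> = char std_normal_distribution t"
    unfolding char_def by (subst integral_density) auto
  also have "\<dots> = of_real (sqrt (2 * pi) * std_normal_density t)"
    unfolding char_std_normal_distribution by (simp add: std_normal_density_def)
  finally show ?thesis .
qed

text \<open>Substitution u = s t in the preceding integral, taken at frequency a / s.\<close>

lemma fourier_std_normal_density_scaled:
  assumes "s > 0"
  shows "(LINT t|lborel. iexp (t * a) * of_real (std_normal_density (s * t)))
    = of_real (sqrt (2 * pi) / s * std_normal_density (a / s))"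
  using lborel_integral_real_affine[of s "\<lambda>u. iexp (a / s * u) * of_real (std_normal_density u)" 0] assms
  unfolding fourier_std_normal_density
  by (simp add: scaleR_conv_of_real field_simps)

text \<open>The Gaussian factor makes the double integrand absolutely integrable, so the order of
  integration can be exchanged using only integrability of g. The t-integral is then a Gaussian in
  (x - y) / s.\<close>

lemma fourier_gaussian_mean:
  assumes g: "integrable lborel g" and "s > 0"
  shows "(LINT t|lborel. iexp (x * t) * fourier g t * of_real (std_normal_density (s * t)))
    = of_real (sqrt (2 * pi)) * (LINT u|lborel. g (x - s * u) * of_real (std_normal_density u))"
proof -
  note [measurable] = borel_measurable_integrable[OF g]
  let ?k = "\<lambda>t y. iexp (t * (x - y)) * of_real (std_normal_density (s * t)) * g y"
  have int_s: "integrable lborel (\<lambda>t. std_normal_density (s * t))"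
    using lborel_integrable_real_affine[OF integrable_normal_density[of 1 0], of s 0] \<open>s > 0\<close> by simp
  have "integrable (lborel \<Otimes>\<^sub>M lborel) (case_prod ?k)"
  proof (rule lborel_pair.Fubini_integrable)
    \<comment> \<open>The inner integral is the L1 norm of g times the Gaussian in s t.\<close>
    show "integrable lborel (\<lambda>t. LINT y|lborel. norm (case_prod ?k (t, y)))"
      using int_s by (simp add: norm_mult)
    have "integrable lborel (\<lambda>y. ?k t y)" for t
      by (rule Bochner_Integration.integrable_bound
          [OF integrable_mult_right[OF g, of "of_real (std_normal_density (s * t))"]])
        (auto simp: norm_mult)
    then show "AE t in lborel. integrable lborel (\<lambda>y. case_prod ?k (t, y))"
      by simp
  qed measurable
  then have "(LINT t|lborel. LINT y|lborel. ?k t y) = (LINT y|lborel. LINT t|lborel. ?k t y)"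
    by (rule lborel_pair.Fubini_integral[symmetric])
  moreover have "(LINT y|lborel. ?k t y) = iexp (x * t) * fourier g t * of_real (std_normal_density (s * t))" for t
  proof -
    have "?k t y = (iexp (x * t) * of_real (std_normal_density (s * t))) * (iexp (- (t * y)) * g y)" for y
      by (simp add: algebra_simps flip: exp_add)
    then show ?thesis
      unfolding fourier_def by (simp only: integral_mult_right_zero) (simp add: mult_ac)
  qed
  moreover have "(LINT t|lborel. ?k t y) = of_real (sqrt (2 * pi) / s * std_normal_density ((x - y) / s)) * g y" for y
    by (simp only: integral_mult_left_zero fourier_std_normal_density_scaled[OF \<open>s > 0\<close>])
  ultimately have "(LINT t|lborel. iexp (x * t) * fourier g t * of_real (std_normal_density (s * t)))
      = (LINT y|lborel. of_real (sqrt (2 * pi) / s * std_normal_density ((x - y) / s)) * g y)"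
    by simp
  \<comment> \<open>Substitution y = x - s u; the Jacobian |-s| = s later cancels the factor 1 /
    s.\<close>
  also have "\<dots> = s *\<^sub>R (LINT u|lborel. of_real (sqrt (2 * pi) / s * std_normal_density u) * g (x - s * u))"
    using \<open>s > 0\<close> lborel_integral_real_affine[of "-s"
        "\<lambda>y. of_real (sqrt (2 * pi) / s * std_normal_density ((x - y) / s)) * g y" x]
    by simp
  also have "\<dots> = s *\<^sub>R (LINT u|lborel. of_real (sqrt (2 * pi) / s) * (g (x - s * u) * of_real (std_normal_density u)))"
    by (simp add: mult_ac)
  also have "\<dots> = of_real (sqrt (2 * pi)) * (LINT u|lborel. g (x - s * u) * of_real (std_normal_density u))"
    using \<open>s > 0\<close> by (simp only: integral_mult_right_zero) (simp add: scaleR_conv_of_real)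
  finally show ?thesis .
qed

text \<open>Both sides of \<open>fourier_gaussian_mean\<close> converge as s tends to 0.
  Integrability of the transform gives the majorant on the left; on the right the bound C gives the
  majorant and continuity of g the pointwise limit.\<close>

theorem fourier_inversion:
  assumes g: "integrable lborel g" and cont: "continuous_on UNIV g" and bd: "\<And>y. norm (g y) \<le> C"
    and F: "integrable lborel (fourier g)"
  shows "(LINT t|lborel. iexp (x * t) * fourier g t) = 2 * of_real pi * g x"
proof -
  note [measurable] = borel_measurable_integrable[OF g] borel_measurable_integrable[OF F]
  let ?\<phi> = std_normal_density
  \<comment> \<open>A positive null sequence, since dominated convergence is applied along
    sequences.\<close>
  define s where "s n = inverse (real (Suc n))" for n
  have s: "s n > 0" "s \<longlonglongrightarrow> 0" for n
    using LIMSEQ_inverse_real_of_nat by (auto simp: s_def[abs_def])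
  have cont\<phi>: "isCont ?\<phi> u" for u
    unfolding std_normal_density_def[abs_def] by (intro continuous_intros) auto
  have \<phi>_le: "?\<phi> u \<le> 1 / sqrt (2 * pi)" for u
    by (simp add: std_normal_density_def divide_simps)
  have lim1: "(\<lambda>n. LINT t|lborel. iexp (x * t) * fourier g t * of_real (?\<phi> (s n * t)))
      \<longlonglongrightarrow> (LINT t|lborel. iexp (x * t) * fourier g t * of_real (?\<phi> 0))"
  proof (rule integral_dominated_convergence)
    show "integrable lborel (\<lambda>t. norm (fourier g t) * (1 / sqrt (2 * pi)))"
      using F by (intro integrable_mult_left integrable_norm)
    show "AE t in lborel. (\<lambda>n. iexp (x * t) * fourier g t * of_real (?\<phi> (s n * t)))
        \<longlonglongrightarrow> iexp (x * t) * fourier g t * of_real (?\<phi> 0)"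
    proof (intro AE_I2 tendsto_intros isCont_tendsto_compose[OF cont\<phi>])
      show "(\<lambda>n. s n * t) \<longlonglongrightarrow> 0" for t
        using tendsto_mult_left_zero[OF s(2)] .
    qed
    show "AE t in lborel. norm (iexp (x * t) * fourier g t * of_real (?\<phi> (s n * t)))
        \<le> norm (fourier g t) * (1 / sqrt (2 * pi))" for n
      using \<phi>_le by (intro AE_I2) (auto simp: norm_mult simp del: times_divide_eq_right intro!: mult_left_mono)
  qed measurable
  have lim2: "(\<lambda>n. LINT u|lborel. g (x - s n * u) * of_real (?\<phi> u)) \<longlonglongrightarrow> (LINT u|lborel. g x * of_real (?\<phi> u))"
  proof (rule integral_dominated_convergence)
    show "integrable lborel (\<lambda>u. C * ?\<phi> u)"
      by (intro integrable_mult_right integrable_normal_density) simp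
    show "AE u in lborel. (\<lambda>n. g (x - s n * u) * of_real (?\<phi> u)) \<longlonglongrightarrow> g x * of_real (?\<phi> u)"
    proof (intro AE_I2 tendsto_intros isCont_tendsto_compose[of _ g])
      show "isCont g x"
        using cont by (simp add: continuous_on_eq_continuous_at)
      show "(\<lambda>n. x - s n * u) \<longlonglongrightarrow> x" for u
        using tendsto_diff[OF tendsto_const[of x] tendsto_mult_left_zero[OF s(2)]] by simp
    qed
    show "AE u in lborel. norm (g (x - s n * u) * of_real (?\<phi> u)) \<le> C * ?\<phi> u" for n
      using bd by (intro AE_I2) (auto simp: norm_mult intro!: mult_right_mono)
  qed measurable
  have "(LINT t|lborel. iexp (x * t) * fourier g t * of_real (?\<phi> 0))
      = of_real (sqrt (2 * pi)) * (LINT u|lborel. g x * of_real (?\<phi> u))"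
    using LIMSEQ_unique[OF lim1[unfolded fourier_gaussian_mean[OF g s(1)]]
        tendsto_mult_left[OF lim2, of "of_real (sqrt (2 * pi))"]] .
  \<comment> \<open>On the left the density at 0 is 1 / sqrt (2 \<pi>); on the right it integrates
    to 1. The two square roots combine to 2 \<pi>.\<close>
  then have "(LINT t|lborel. iexp (x * t) * fourier g t) / of_real (sqrt (2 * pi)) = of_real (sqrt (2 * pi)) * g x"
    by (simp add: std_normal_density_def[of 0])
  then have "(LINT t|lborel. iexp (x * t) * fourier g t) = of_real (sqrt (2 * pi) * sqrt (2 * pi)) * g x"
    unfolding of_real_mult by (simp add: divide_eq_eq)
  then show ?thesis by simp
qed

section \<open>Quantization of a monomial\<close>

text \<open>This is the Fourier formula for p^l, paired with a Schwartz function. The two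
  integrability claims allow the sum over k to be exchanged with the x'-integral and the p-integral
  in the final theorem.\<close>

lemma osc_pairing_power:
  assumes hbar: "hbar > 0" and f: "f \<in> schwartz"
  shows "osc_pairing hbar x (\<lambda>x' p. of_real (p ^ l)) f = (p_op hbar ^^ l) f x"
    and "integrable lborel (\<lambda>x'. exp (\<i> / of_real hbar * of_real (p * (x - x'))) * of_real (p ^ l) * f x')"
    and "integrable lborel (\<lambda>p. LINT x'|lborel.
      exp (\<i> / of_real hbar * of_real (p * (x - x'))) * of_real (p ^ l) * f x')"
proof -
  let ?e = "\<lambda>p x'. exp (\<i> / of_real hbar * of_real (p * (x - x')))"
  let ?g = "(D ^^ l) f"
  let ?c = "(- \<i> * of_real hbar) ^ l"
  have g: "?g \<in> schwartz" by (rule schwartz_funpow_D[OF f])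
  have e: "?e p x' = iexp (p / hbar * x) * iexp (- (p / hbar * x'))" for p x'
    by (simp add: algebra_simps diff_divide_distrib flip: exp_add)
  show "integrable lborel (\<lambda>x'. ?e p x' * of_real (p ^ l) * f x')" for p
    using integrable_mult_right[OF integrable_iexp_mult[OF schwartz_integrable[OF f], of "- (p / hbar)"],
        of "iexp (p / hbar * x) * of_real (p ^ l)"]
    by (simp only: e) (simp add: mult_ac)
  \<comment> \<open>Since -\<i> * \<i> = 1, p^l splits into the constant of \<open>p_op\<close> and
    the Fourier multiplier of \<open>D ^^ l\<close> at frequency p / hbar.\<close>
  have p_power: "of_real (p ^ l) = ?c * (\<i> * of_real (p / hbar)) ^ l" for p
    using hbar by (simp flip: power_mult_distrib)
  have inner: "(LINT x'|lborel. ?e p x' * of_real (p ^ l) * f x')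
      = ?c * (iexp (x * (p / hbar)) * fourier ?g (p / hbar))" for p
  proof -
    have "(LINT x'|lborel. ?e p x' * of_real (p ^ l) * f x')
        = (LINT x'|lborel. (iexp (p / hbar * x) * of_real (p ^ l)) * (iexp (- (p / hbar * x')) * f x'))"
      by (simp only: e mult_ac)
    also have "\<dots> = iexp (p / hbar * x) * of_real (p ^ l) * fourier f (p / hbar)"
      unfolding fourier_def by (rule integral_mult_right_zero)
    also have "\<dots> = ?c * (iexp (x * (p / hbar)) * fourier ?g (p / hbar))"
      unfolding p_power fourier_funpow_D[OF f] by (simp only: mult_ac)
    finally show ?thesis .
  qed
  have int: "integrable lborel (\<lambda>t. iexp (x * t) * fourier ?g t)"
    by (intro integrable_iexp_mult fourier_integrable g)
  show "integrable lborel (\<lambda>p. LINT x'|lborel. ?e p x' * of_real (p ^ l) * f x')"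
    unfolding inner using lborel_integrable_real_affine[OF int, of "1 / hbar" 0] hbar
    by (intro integrable_mult_right) simp
  obtain C where C: "\<And>y. norm (?g y) \<le> C"
    using schwartz_bounded[OF g] by blast
  \<comment> \<open>Substitution t = p / hbar. The Jacobian hbar and the 2 \<pi> from inversion
    cancel the prefactor of \<open>osc_pairing\<close>.\<close>
  have "(LINT p|lborel. iexp (x * (p / hbar)) * fourier ?g (p / hbar)) =
      hbar *\<^sub>R (LINT t|lborel. iexp (x * t) * fourier ?g t)"
    using hbar lborel_integral_real_affine[of "1 / hbar" "\<lambda>t. iexp (x * t) * fourier ?g t" 0]
    by simp
  also have "\<dots> = hbar *\<^sub>R (2 * of_real pi * ?g x)"
    by (subst fourier_inversion[OF schwartz_integrable[OF g] schwartz_continuous[OF g] C fourier_integrable[OF g]]) simp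
  finally show "osc_pairing hbar x (\<lambda>x' p. of_real (p ^ l)) f = (p_op hbar ^^ l) f x"
    using hbar unfolding osc_pairing_def inner integral_mult_right_zero
    by (simp add: funpow_p_op[OF f] scaleR_conv_of_real)
qed

text \<open>A primitive in \<tau> is the power m + 1 divided by (m + 1) (x - y), and the difference
  of its end values factors as a geometric sum. The case x = y is separate because this primitive
  degenerates; there the integrand is constant and all m + 1 summands agree.\<close>

lemma integral_power_segment:
  fixes x y :: real
  shows "(LINT \<tau>:{0..1}|lborel. (\<tau> * x + (1 - \<tau>) * y) ^ m)
    = 1 / (real m + 1) * (\<Sum>k=0..m. x ^ k * y ^ (m - k))"
proof (cases "x = y")
  case True
  have "(\<tau> * y + (1 - \<tau>) * y) = y" for \<tau> :: real
    by (simp add: algebra_simps)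
  moreover have "(\<Sum>k=0..m. y ^ k * y ^ (m - k)) = (real m + 1) * y ^ m"
    by (simp flip: power_add)
  ultimately show ?thesis
    using True by (simp add: set_lebesgue_integral_def)
next
  case False
  let ?F = "\<lambda>\<tau>. (\<tau> * x + (1 - \<tau>) * y) ^ Suc m / ((real m + 1) * (x - y))"
  have "(LINT \<tau>:{0..1}|lborel. (\<tau> * x + (1 - \<tau>) * y) ^ m) = (LBINT \<tau>=0..1. (\<tau> * x + (1 - \<tau>) * y) ^ m)"
    using interval_integral_Icc[of 0 1 "\<lambda>\<tau>. (\<tau> * x + (1 - \<tau>) * y) ^ m"]
    by (simp add: zero_ereal_def one_ereal_def)
  also have "\<dots> = ?F 1 - ?F 0"
    unfolding zero_ereal_def one_ereal_def
  proof (rule interval_integral_FTC_finite)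
    show "(?F has_vector_derivative (\<tau> * x + (1 - \<tau>) * y) ^ m) (at \<tau> within {min 0 1..max 0 1})" for \<tau>
    proof -
      have "((\<lambda>\<tau>. \<tau> * x + (1 - \<tau>) * y) has_real_derivative x - y) (at \<tau> within {min 0 1..max 0 1})"
        by (auto intro!: derivative_eq_intros)
      from DERIV_cdivide[OF DERIV_power_Suc[OF this, of m], of "(real m + 1) * (x - y)"]
      show ?thesis
        unfolding has_real_derivative_iff_has_vector_derivative[symmetric] using False
        by (simp add: add.commute[of 1] add_nonneg_eq_0_iff)
    qed
  qed (intro continuous_intros)
  also have "\<dots> = (x ^ Suc m - y ^ Suc m) / ((real m + 1) * (x - y))"
    by (simp add: diff_divide_distrib)
  also have "\<dots> = 1 / (real m + 1) * (\<Sum>k=0..m. x ^ k * y ^ (m - k))"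
    unfolding diff_power_eq_sum using False by (simp add: lessThan_Suc_atMost atMost_atLeast0 del: power_Suc)
  finally show ?thesis .
qed

text \<open>The operator ordering reflects the two variables: x^k is constant under both integrals
  and ends up left of \<open>p_op hbar ^^ l\<close>, while x'^(m-k) multiplies \<psi> before
  \<open>p_op\<close> acts.\<close>

theorem mainTheorem2:
  fixes hbar :: real and m l :: nat and \<psi> :: "real \<Rightarrow> complex"
  assumes "hbar > 0" and "\<psi> \<in> schwartz"
  shows "born_jordan_quantization hbar (\<lambda>x p. of_real (x ^ m * p ^ l)) \<psi> =
    (\<lambda>x. 1 / (of_nat m + 1) *
       (\<Sum>k=0..m. ((x_op ^^ k) \<circ> (p_op hbar ^^ l) \<circ> (x_op ^^ (m - k))) \<psi> x))"
proof
  fix x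
  let ?e = "\<lambda>p x'. exp (\<i> / of_real hbar * of_real (p * (x - x')))"
  let ?f = "\<lambda>k. (x_op ^^ (m - k)) \<psi>"
  let ?I = "\<lambda>k p. LINT x'|lborel. ?e p x' * of_real (p ^ l) * ?f k x'"
  let ?c = "1 / (of_nat m + 1) :: complex"
  note osc = osc_pairing_power[OF assms(1) schwartz_funpow_x_op[OF assms(2)]]
  have avg: "(LINT \<tau>:{0..1}|lborel. of_real ((\<tau> * x + (1 - \<tau>) * x') ^ m * p ^ l) :: complex)
      = ?c * (\<Sum>k=0..m. of_real (x ^ k * x' ^ (m - k))) * of_real (p ^ l)" for x' p
  proof -
    have "(LINT \<tau>:{0..1}|lborel. of_real ((\<tau> * x + (1 - \<tau>) * x') ^ m * p ^ l) :: complex)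
        = of_real ((LINT \<tau>:{0..1}|lborel. (\<tau> * x + (1 - \<tau>) * x') ^ m) * p ^ l)"
      by (simp only: set_integral_complex_of_real set_integral_mult_left)
    then show ?thesis
      by (simp add: integral_power_segment)
  qed
  \<comment> \<open>The sum is split while p is still fixed; \<open>osc(2)\<close> makes each
    summand integrable in x'.\<close>
  have "(LINT x'|lborel. ?e p x' * (LINT \<tau>:{0..1}|lborel. of_real ((\<tau> * x + (1 - \<tau>) * x') ^ m * p ^ l)) * \<psi> x')
      = ?c * (\<Sum>k=0..m. of_real (x ^ k) * ?I k p)" for p
  proof -
    have "(LINT x'|lborel. ?e p x' * (LINT \<tau>:{0..1}|lborel. of_real ((\<tau> * x + (1 - \<tau>) * x') ^ m * p ^ l)) * \<psi> x')
        = (LINT x'|lborel. ?c * (\<Sum>k=0..m. of_real (x ^ k) * (?e p x' * of_real (p ^ l) * ?f k x')))"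
      unfolding avg funpow_x_op
      by (intro Bochner_Integration.integral_cong refl)
        (simp add: sum_distrib_left sum_distrib_right mult_ac)
    also have "\<dots> = ?c * (\<Sum>k=0..m. of_real (x ^ k) * ?I k p)"
      using osc(2) by (simp only: integral_mult_right_zero) (subst Bochner_Integration.integral_sum, auto)
    finally show ?thesis .
  qed
  then have "born_jordan_quantization hbar (\<lambda>x p. of_real (x ^ m * p ^ l)) \<psi> x
      = 1 / (2 * of_real pi * of_real hbar) * (LINT p|lborel. ?c * (\<Sum>k=0..m. of_real (x ^ k) * ?I k p))"
    by (simp only: born_jordan_quantization_def osc_pairing_def)
  \<comment> \<open>Splitting the outer integral uses \<open>osc(3)\<close>: after pairing with a
    Schwartz function, each summand is integrable in p.\<close>
  also have "(LINT p|lborel. ?c * (\<Sum>k=0..m. of_real (x ^ k) * ?I k p))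
      = ?c * (\<Sum>k=0..m. of_real (x ^ k) * (LINT p|lborel. ?I k p))"
    using osc(3) by (simp only: integral_mult_right_zero) (subst Bochner_Integration.integral_sum, auto)
  also have "1 / (2 * of_real pi * of_real hbar) * \<dots>
      = ?c * (\<Sum>k=0..m. of_real (x ^ k) * osc_pairing hbar x (\<lambda>x' p. of_real (p ^ l)) (?f k))"
    unfolding osc_pairing_def by (simp only: sum_distrib_left mult_ac)
  also have "\<dots> = ?c * (\<Sum>k=0..m. ((x_op ^^ k) \<circ> (p_op hbar ^^ l) \<circ> (x_op ^^ (m - k))) \<psi> x)"
    by (simp only: osc(1) o_apply funpow_x_op[of _ "(p_op hbar ^^ l) _"])
  finally show "born_jordan_quantization hbar (\<lambda>x p. of_real (x ^ m * p ^ l)) \<psi> x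
      = ?c * (\<Sum>k=0..m. ((x_op ^^ k) \<circ> (p_op hbar ^^ l) \<circ> (x_op ^^ (m - k))) \<psi> x)" .
qed

end
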